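(* Let $T>0$ and let $0\ne v\in H^s_{0,}(0,T)=[H^1_{0,}(0,T),L^2(0,T)]_s$ with $s\in(0,1]$. Then the inequality $$\langle v,\mathcal{H}_Tv\rangle_{L^2(0,T)}>0$$ holds true.
   Context: Every $v\in L^2(0,T)$ has the expansion $v(t)=\sum_{k=0}^\infty v_k\sin\big((\frac\pi2+k\pi)\frac tT\big)$ with $v_k=\frac2T\int_0^Tv(t)\sin\big((\frac\pi2+k\pi)\frac tT\big)\,dt$. The modified Hilbert transformation $\mathcal{H}_T:L^2(0,T)\to L^2(0,T)$ is defined by $(\mathcal{H}_Tv)(t)=\sum_{k=0}^\infty v_k\cos\big((\frac\pi2+k\pi)\frac tT\big)$. $H^1_{0,}(0,T)=\{v\in H^1(0,T):v(0)=0\}$ with norm $\|\partial_tv\|_{L^2(0,T)}$. For $s\in(0,1)$, $H^s_{0,}(0,T)=[H^1_{0,}(0,T),L^2(0,T)]_s$ is the interpolation space, with the index normalized so that $s=1$ corresponds to $H^1_{0,}(0,T)$ and $s=0$ to $L^2(0,T)$; it is equipped with the norm in Fourier representation $$\|v\|_{H^s_{0,}(0,T)}=\Big(\frac T2\sum_{k=0}^\infty\Big[\frac1T\Big(\frac\pi2+k\pi\Big)\Big]^{2s}v_k^2\Big)^{1/2},$$ i.e. it consists of those $v\in L^2(0,T)$ for which this quantity is finite. *)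

theory Defs
  imports "HOL-Analysis.Analysis"
begin

text \<open>
  Elements of \<open>L\<^sup>2(0,T)\<close> are represented by real-valued, Lebesgue measurable functions on
  \<open>(0,T)\<close>; equality in \<open>L\<^sup>2(0,T)\<close> is equality almost everywhere on \<open>(0,T)\<close>.
\<close>

abbreviation interval_measure_0T :: "real \<Rightarrow> real measure" where
  "interval_measure_0T T \<equiv> lebesgue_on {0<..<T}"

definition L2_space :: "real \<Rightarrow> (real \<Rightarrow> real) set" where
  "L2_space T = {v. v \<in> borel_measurable (interval_measure_0T T) \<and>
                    integrable (interval_measure_0T T) (\<lambda>t. (v t)\<^sup>2)}"

definition L2_inner :: "real \<Rightarrow> (real \<Rightarrow> real) \<Rightarrow> (real \<Rightarrow> real) \<Rightarrow> real" where
  "L2_inner T u v = (\<integral>t. u t * v t \<partial>interval_measure_0T T)"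

definition L2_norm :: "real \<Rightarrow> (real \<Rightarrow> real) \<Rightarrow> real" where
  "L2_norm T v = sqrt (L2_inner T v v)"

definition L2_eq :: "real \<Rightarrow> (real \<Rightarrow> real) \<Rightarrow> (real \<Rightarrow> real) \<Rightarrow> bool" where
  "L2_eq T u v \<longleftrightarrow> (AE t in interval_measure_0T T. u t = v t)"

definition freq :: "nat \<Rightarrow> real" where
  "freq k = pi / 2 + real k * pi"

definition sine_coeff :: "real \<Rightarrow> (real \<Rightarrow> real) \<Rightarrow> nat \<Rightarrow> real" where
  "sine_coeff T v k = 2 / T * (\<integral>t. v t * sin (freq k * (t / T)) \<partial>interval_measure_0T T)"

text \<open>
  The cosine series converges in the norm of \<open>L\<^sup>2(0,T)\<close>, not necessarily pointwise. Its limit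
  is unique up to null sets; \<open>modified_Hilbert T v\<close> is one representative of that limit.
\<close>

definition modified_Hilbert :: "real \<Rightarrow> (real \<Rightarrow> real) \<Rightarrow> (real \<Rightarrow> real)" where
  "modified_Hilbert T v =
     (SOME w. w \<in> L2_space T \<and>
        (\<lambda>n. L2_norm T (\<lambda>t. w t - (\<Sum>k<n. sine_coeff T v k * cos (freq k * (t / T)))))
          \<longlonglongrightarrow> 0)"

definition test_function :: "real \<Rightarrow> (real \<Rightarrow> real) \<Rightarrow> bool" where
  "test_function T \<phi> \<longleftrightarrow>
     (\<forall>n x. (deriv ^^ n) \<phi> field_differentiable (at x)) \<and>
     compact (closure {x. \<phi> x \<noteq> 0}) \<and> closure {x. \<phi> x \<noteq> 0} \<subseteq> {0<..<T}"

definition weak_derivative :: "real \<Rightarrow> (real \<Rightarrow> real) \<Rightarrow> (real \<Rightarrow> real) \<Rightarrow> bool" where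
  "weak_derivative T v g \<longleftrightarrow>
     (\<forall>\<phi>. test_function T \<phi> \<longrightarrow> L2_inner T v (deriv \<phi>) = - L2_inner T g \<phi>)"

definition H1_space :: "real \<Rightarrow> (real \<Rightarrow> real) set" where
  "H1_space T = {v \<in> L2_space T. \<exists>g \<in> L2_space T. weak_derivative T v g}"

text \<open>
  The condition \<open>v(0) = 0\<close> refers to the continuous representative of \<open>v\<close> on \<open>[0,T]\<close>.
\<close>

definition H1_0_space :: "real \<Rightarrow> (real \<Rightarrow> real) set" where
  "H1_0_space T =
     {v \<in> H1_space T. \<exists>w. continuous_on {0..T} w \<and> L2_eq T v w \<and> w 0 = 0}"

text \<open>
  For \<open>0 < s < 1\<close> the interpolation space is given by its Fourier representation: the norm
  \<open>(T/2 \<Sum>\<^sub>k [freq k / T]\<^bsup>2s\<^esup> v\<^sub>k\<^sup>2)\<^bsup>1/2\<^esup>\<close> is finite exactly if the series of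
  nonnegative terms below is summable. The endpoint \<open>s = 1\<close> is the Sobolev space itself.
\<close>

definition Hs_0_space :: "real \<Rightarrow> real \<Rightarrow> (real \<Rightarrow> real) set" where
  "Hs_0_space T s =
     (if s = 1 then H1_0_space T
      else {v \<in> L2_space T.
              summable (\<lambda>k. (1 / T * freq k) powr (2 * s) * (sine_coeff T v k)\<^sup>2)})"

end

theory Submission
  imports Defs
begin

text \<open>
  Let \<open>a\<^sub>k\<close> be the sine coefficients of \<open>v\<close>. The sine and cosine partial sums \<open>S\<^sub>n\<close>, \<open>C\<^sub>n\<close> converge in
  \<open>L\<^sup>2(0,T)\<close> to \<open>v\<close> and \<open>\<H>\<^sub>T v\<close>, and
  \<open>\<langle>S\<^sub>n, C\<^sub>n\<rangle> = T/(2\<pi>) \<integral> (\<Sum>k<n. a\<^sub>k x\<^sup>k)\<^sup>2 dx\<close> over \<open>[-1,1]\<close>, since the integral of \<open>sin ((k+l+1)\<pi>t/T)\<close> over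
  \<open>(0,T)\<close> is \<open>T/\<pi>\<close> times the integral of \<open>x\<^bsup>k+l\<^esup>\<close> over \<open>[-1,1]\<close>. The first nonzero coefficient, which exists by totality
  of the sines, keeps these integrals away from \<open>0\<close> as \<open>n\<close> grows.
\<close>

subsection \<open>Square integrable functions and orthogonal sequences\<close>

text \<open>Kept over an arbitrary measure so that the abstract Hilbert space arguments are separate
  from the interval; \<open>L2_space_eq\<close> makes the link.\<close>

definition square_integrable :: "'a measure \<Rightarrow> ('a \<Rightarrow> real) \<Rightarrow> bool" where
  "square_integrable M f \<longleftrightarrow> f \<in> borel_measurable M \<and> integrable M (\<lambda>x. (f x)\<^sup>2)"

lemma square_integrable_mult_integrable:
  assumes "square_integrable M f" "square_integrable M g"
  shows "integrable M (\<lambda>x. f x * g x)"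
proof (rule Bochner_Integration.integrable_bound)
  show "integrable M (\<lambda>x. (f x)\<^sup>2 + (g x)\<^sup>2)"
    using assms by (simp add: square_integrable_def)
  show "(\<lambda>x. f x * g x) \<in> borel_measurable M"
    using assms by (intro borel_measurable_times) (simp_all add: square_integrable_def)
  have "\<bar>a * b\<bar> \<le> a\<^sup>2 + b\<^sup>2" for a b :: real
  proof -
    have "0 \<le> (\<bar>a\<bar> - \<bar>b\<bar>)\<^sup>2" by simp
    then have "2 * \<bar>a * b\<bar> \<le> a\<^sup>2 + b\<^sup>2"
      by (simp add: power2_diff abs_mult)
    then show ?thesis using abs_ge_zero[of "a * b"] by linarith
  qed
  then show "AE x in M. norm (f x * g x) \<le> norm ((f x)\<^sup>2 + (g x)\<^sup>2)"
    by simp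
qed

lemma square_integrable_add:
  assumes "square_integrable M f" "square_integrable M g"
  shows "square_integrable M (\<lambda>x. f x + g x)"
  using assms square_integrable_mult_integrable[OF assms]
  by (auto simp: square_integrable_def power2_sum mult.assoc)

lemma square_integrable_cmult:
  "square_integrable M f \<Longrightarrow> square_integrable M (\<lambda>x. c * f x)"
  by (auto simp: square_integrable_def power_mult_distrib)

lemma square_integrable_diff:
  assumes "square_integrable M f" "square_integrable M g"
  shows "square_integrable M (\<lambda>x. f x - g x)"
  using square_integrable_add[OF assms(1) square_integrable_cmult[OF assms(2), of "-1"]] by simp

lemma square_integrable_zero: "square_integrable M (\<lambda>x. 0)"
  by (simp add: square_integrable_def)

lemma square_integrable_sum:
  "(\<And>i. i \<in> I \<Longrightarrow> square_integrable M (f i)) \<Longrightarrow> square_integrable M (\<lambda>x. \<Sum>i\<in>I. f i x)"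
  by (induction I rule: infinite_finite_induct)
     (simp_all add: square_integrable_add square_integrable_zero)

text \<open>The integral of \<open>(a * f - b * g)^2\<close> is nonnegative for all real
  \<open>a\<close>, \<open>b\<close>, and two choices of these parameters give the
  inequality.\<close>

lemma integral_Cauchy_Schwarz:
  fixes f g :: "'a \<Rightarrow> real"
  assumes f: "square_integrable M f" and g: "square_integrable M g"
  shows "\<bar>\<integral>x. f x * g x \<partial>M\<bar> \<le> sqrt (\<integral>x. (f x)\<^sup>2 \<partial>M) * sqrt (\<integral>x. (g x)\<^sup>2 \<partial>M)"
proof -
  let ?A = "\<integral>x. (f x)\<^sup>2 \<partial>M" and ?B = "\<integral>x. (g x)\<^sup>2 \<partial>M" and ?C = "\<integral>x. f x * g x \<partial>M"
  have i: "integrable M (\<lambda>x. (f x)\<^sup>2)" "integrable M (\<lambda>x. (g x)\<^sup>2)" "integrable M (\<lambda>x. f x * g x)"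
    using f g square_integrable_mult_integrable[OF f g] by (auto simp: square_integrable_def)
  have nn: "0 \<le> a\<^sup>2 * ?A - 2 * a * b * ?C + b\<^sup>2 * ?B" for a b :: real
  proof -
    have "0 \<le> (\<integral>x. (a * f x - b * g x)\<^sup>2 \<partial>M)" by simp
    also have "(\<lambda>x. (a * f x - b * g x)\<^sup>2) =
        (\<lambda>x. a\<^sup>2 * (f x)\<^sup>2 - (2 * a * b) * (f x * g x) + b\<^sup>2 * (g x)\<^sup>2)"
      by (simp add: fun_eq_iff power2_diff power_mult_distrib algebra_simps)
    also have "(\<integral>x. \<dots> x \<partial>M) = a\<^sup>2 * ?A - (2 * a * b) * ?C + b\<^sup>2 * ?B"
      using i by simp
    finally show ?thesis by simp
  qed
  have "?C\<^sup>2 \<le> ?A * ?B"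
  proof (cases "?B = 0")
    case True
    have "?C = 0"
    proof (rule ccontr)
      assume "?C \<noteq> 0"
      \<comment> \<open>With \<open>?B = 0\<close> this \<open>b\<close> turns the quadratic form
        into \<open>?A - (?A + 1) = -1\<close>.\<close>
      then show False using nn[of 1 "(?A + 1) / (2 * ?C)"] True by simp
    qed
    then show ?thesis using True by simp
  next
    case False
    then have "?B > 0" using Bochner_Integration.integral_nonneg[of M "\<lambda>x. (g x)\<^sup>2"] by (simp add: less_le)
    \<comment> \<open>The choice \<open>a = ?B\<close>, \<open>b = ?C\<close> minimises the form up
      to scaling and lets \<open>?B\<close> be factored out.\<close>
    have "0 \<le> ?B * (?A * ?B - ?C\<^sup>2)"
      using nn[of ?B ?C] by (simp add: power2_eq_square algebra_simps)
    then show ?thesis using \<open>?B > 0\<close> by (simp add: zero_le_mult_iff)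
  qed
  then have "sqrt (?C\<^sup>2) \<le> sqrt (?A * ?B)" by (simp only: real_sqrt_le_iff)
  then show ?thesis by (simp add: real_sqrt_mult)
qed

text \<open>Joint continuity of the inner product: the error splits into three products, each
  containing a factor that tends to 0, and Cauchy-Schwarz bounds each of them.\<close>

lemma tendsto_integral_mult:
  fixes f g :: "nat \<Rightarrow> 'a \<Rightarrow> real"
  assumes f: "\<And>n. square_integrable M (f n)" and u: "square_integrable M u"
    and g: "\<And>n. square_integrable M (g n)" and v: "square_integrable M v"
    and fu: "(\<lambda>n. \<integral>x. (f n x - u x)\<^sup>2 \<partial>M) \<longlonglongrightarrow> 0"
    and gv: "(\<lambda>n. \<integral>x. (g n x - v x)\<^sup>2 \<partial>M) \<longlonglongrightarrow> 0"
  shows "(\<lambda>n. \<integral>x. f n x * g n x \<partial>M) \<longlonglongrightarrow> (\<integral>x. u x * v x \<partial>M)"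
proof -
  let ?F = "\<lambda>n. sqrt (\<integral>x. (f n x - u x)\<^sup>2 \<partial>M)" and ?G = "\<lambda>n. sqrt (\<integral>x. (g n x - v x)\<^sup>2 \<partial>M)"
  let ?U = "sqrt (\<integral>x. (u x)\<^sup>2 \<partial>M)" and ?V = "sqrt (\<integral>x. (v x)\<^sup>2 \<partial>M)"
  have lim: "(\<lambda>n. ?F n * ?G n + ?F n * ?V + ?U * ?G n) \<longlonglongrightarrow> 0"
    using fu gv by (auto intro!: tendsto_eq_intros)
  have bd: "norm ((\<integral>x. f n x * g n x \<partial>M) - (\<integral>x. u x * v x \<partial>M)) \<le> ?F n * ?G n + ?F n * ?V + ?U * ?G n" for n
  proof -
    have df: "square_integrable M (\<lambda>x. f n x - u x)" and dg: "square_integrable M (\<lambda>x. g n x - v x)"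
      by (rule square_integrable_diff[OF f u], rule square_integrable_diff[OF g v])
    have "(\<integral>x. f n x * g n x \<partial>M) = (\<integral>x. (f n x - u x) * (g n x - v x) + (f n x - u x) * v x
        + u x * (g n x - v x) + u x * v x \<partial>M)"
      by (intro Bochner_Integration.integral_cong refl) (simp add: algebra_simps)
    also have "\<dots> = (\<integral>x. (f n x - u x) * (g n x - v x) \<partial>M) + (\<integral>x. (f n x - u x) * v x \<partial>M)
        + (\<integral>x. u x * (g n x - v x) \<partial>M) + (\<integral>x. u x * v x \<partial>M)"
      by (simp only: Bochner_Integration.integral_add Bochner_Integration.integrable_add
            square_integrable_mult_integrable[OF df dg] square_integrable_mult_integrable[OF df v]
            square_integrable_mult_integrable[OF u dg] square_integrable_mult_integrable[OF u v])
    finally show ?thesis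
      using integral_Cauchy_Schwarz[OF df dg] integral_Cauchy_Schwarz[OF df v]
        integral_Cauchy_Schwarz[OF u dg] by simp
  qed
  have "(\<lambda>n. (\<integral>x. f n x * g n x \<partial>M) - (\<integral>x. u x * v x \<partial>M)) \<longlonglongrightarrow> 0"
    by (rule Lim_null_comparison[OF always_eventually lim]) (use bd in blast)
  then show ?thesis by (simp add: LIM_zero_iff)
qed

text \<open>On a finite measure space a Cauchy sequence in L^2 is Cauchy in L^1, so a subsequence
  converges almost everywhere. Fatou's lemma then upgrades this pointwise limit to a limit in L^2 of
  the whole sequence.\<close>

theorem (in finite_measure) Riesz_Fischer:
  fixes S :: "nat \<Rightarrow> 'a \<Rightarrow> real"
  assumes S: "\<And>n. square_integrable M (S n)"
    and Cauchy: "\<And>e. e > 0 \<Longrightarrow> \<exists>N. \<forall>m\<ge>N. \<forall>n\<ge>N. (\<integral>x. (S m x - S n x)\<^sup>2 \<partial>M) < e"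
  obtains w where "square_integrable M w" "(\<lambda>n. \<integral>x. (S n x - w x)\<^sup>2 \<partial>M) \<longlonglongrightarrow> 0"
proof -
  have one: "square_integrable M (\<lambda>x. 1)" by (simp add: square_integrable_def)
  have dS: "square_integrable M (\<lambda>x. S m x - S n x)" for m n
    by (rule square_integrable_diff[OF S S])
  have [measurable]: "S n \<in> borel_measurable M" for n
    using S by (simp add: square_integrable_def)
  \<comment> \<open>The added 1 keeps \<open>K\<close> positive when the space has measure 0, so
    that division by \<open>K\<close> is safe.\<close>
  define K where "K = measure M (space M) + 1"
  have K: "K > 0" using measure_nonneg[of M "space M"] unfolding K_def by linarith
  have L1: "(\<integral>x. norm (S m x - S n x) \<partial>M) \<le> sqrt (\<integral>x. (S m x - S n x)\<^sup>2 \<partial>M) * sqrt K" for m n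
  proof -
    have "square_integrable M (\<lambda>x. norm (S m x - S n x))"
      using dS[of m n] by (simp add: square_integrable_def)
    from integral_Cauchy_Schwarz[OF this one]
    have "(\<integral>x. norm (S m x - S n x) \<partial>M) \<le>
        sqrt (\<integral>x. (S m x - S n x)\<^sup>2 \<partial>M) * sqrt (measure M (space M))" by simp
    also have "\<dots> \<le> sqrt (\<integral>x. (S m x - S n x)\<^sup>2 \<partial>M) * sqrt K"
      by (intro mult_left_mono) (simp_all add: K_def)
    finally show ?thesis .
  qed
  obtain r where r: "strict_mono r" and AEC: "AE x in M. Cauchy (\<lambda>i. S (r i) x)"
  proof (rule cauchy_L1_AE_cauchy_subseq[of M S])
    show "integrable M (S n)" for n
      using square_integrable_mult_integrable[OF S[of n] one] by simp
    fix e :: real assume e: "e > 0"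
    \<comment> \<open>This tolerance is chosen so that its square root times \<open>sqrt K\<close>,
      the factor in \<open>L1\<close>, is exactly \<open>e\<close>.\<close>
    from Cauchy[of "e\<^sup>2 / K"] e K obtain N
      where N: "\<And>m n. m \<ge> N \<Longrightarrow> n \<ge> N \<Longrightarrow> (\<integral>x. (S m x - S n x)\<^sup>2 \<partial>M) < e\<^sup>2 / K" by auto
    have "(\<integral>x. norm (S m x - S n x) \<partial>M) < e" if "m \<ge> N" "n \<ge> N" for m n
    proof -
      have "sqrt (\<integral>x. (S m x - S n x)\<^sup>2 \<partial>M) * sqrt K < sqrt (e\<^sup>2 / K) * sqrt K"
        using N[OF that] K by (intro mult_strict_right_mono) auto
      also have "\<dots> = e" using e K by (simp add: real_sqrt_divide)
      finally show ?thesis using L1[of m n] by linarith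
    qed
    then show "\<exists>N. \<forall>i\<ge>N. \<forall>j\<ge>N. (\<integral>x. norm (S i x - S j x) \<partial>M) < e" by blast
  qed blast
  \<comment> \<open>\<open>lim\<close> assigns some value at every point, which makes
    \<open>w\<close> a measurable function; only the points of convergence matter below.\<close>
  define w where "w x = lim (\<lambda>i. S (r i) x)" for x
  have [measurable]: "w \<in> borel_measurable M" unfolding w_def by measurable
  have AEw: "AE x in M. (\<lambda>i. S (r i) x) \<longlonglongrightarrow> w x"
    using AEC by eventually_elim (simp add: w_def Cauchy_convergent_iff convergent_LIMSEQ_iff)
  \<comment> \<open>With \<open>n\<close> fixed, the second index runs to infinity along the
    subsequence \<open>r\<close>, so a bound for all late \<open>m\<close> survives in the
    limit.\<close>
  have Fatou: "(\<integral>\<^sup>+x. ennreal ((S n x - w x)\<^sup>2) \<partial>M) \<le> ennreal e"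
    if "\<And>m. m \<ge> N \<Longrightarrow> (\<integral>x. (S n x - S m x)\<^sup>2 \<partial>M) \<le> e" for n N e
  proof -
    have "(\<integral>\<^sup>+x. ennreal ((S n x - w x)\<^sup>2) \<partial>M) =
        (\<integral>\<^sup>+x. liminf (\<lambda>i. ennreal ((S n x - S (r i) x)\<^sup>2)) \<partial>M)"
    proof (rule nn_integral_cong_AE)
      show "AE x in M. ennreal ((S n x - w x)\<^sup>2) = liminf (\<lambda>i. ennreal ((S n x - S (r i) x)\<^sup>2))"
        using AEw
      proof eventually_elim
        case (elim x)
        then have "(\<lambda>i. ennreal ((S n x - S (r i) x)\<^sup>2)) \<longlonglongrightarrow> ennreal ((S n x - w x)\<^sup>2)"
          by (intro tendsto_ennrealI tendsto_intros)
        then show ?case by (metis lim_imp_Liminf sequentially_bot)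
      qed
    qed
    also have "\<dots> \<le> liminf (\<lambda>i. \<integral>\<^sup>+x. ennreal ((S n x - S (r i) x)\<^sup>2) \<partial>M)"
      by (rule nn_integral_liminf) measurable
    also have "\<dots> \<le> ennreal e"
    proof (rule Liminf_le)
      show "\<forall>\<^sub>F i in sequentially. (\<integral>\<^sup>+x. ennreal ((S n x - S (r i) x)\<^sup>2) \<partial>M) \<le> ennreal e"
        using eventually_ge_at_top[of N]
      proof eventually_elim
        case (elim i)
        then have "N \<le> r i" using seq_suble[OF r, of i] by linarith
        moreover have "(\<integral>\<^sup>+x. ennreal ((S n x - S (r i) x)\<^sup>2) \<partial>M) =
            ennreal (\<integral>x. (S n x - S (r i) x)\<^sup>2 \<partial>M)"
          using dS by (intro nn_integral_eq_integral) (auto simp: square_integrable_def)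
        ultimately show ?case using that by (simp add: ennreal_leI)
      qed
    qed simp
    finally show ?thesis .
  qed
  have small: "\<exists>N. \<forall>n\<ge>N. integrable M (\<lambda>x. (S n x - w x)\<^sup>2) \<and> (\<integral>x. (S n x - w x)\<^sup>2 \<partial>M) \<le> e"
    if e: "e > 0" for e
  proof -
    obtain N where N: "\<And>m n. m \<ge> N \<Longrightarrow> n \<ge> N \<Longrightarrow> (\<integral>x. (S m x - S n x)\<^sup>2 \<partial>M) < e"
      using Cauchy[OF e] by blast
    have "integrable M (\<lambda>x. (S n x - w x)\<^sup>2) \<and> (\<integral>x. (S n x - w x)\<^sup>2 \<partial>M) \<le> e" if "n \<ge> N" for n
    proof -
      have le: "(\<integral>\<^sup>+x. ennreal ((S n x - w x)\<^sup>2) \<partial>M) \<le> ennreal e"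
        using N[OF that] by (intro Fatou[of N]) (auto intro: less_imp_le)
      then have i: "integrable M (\<lambda>x. (S n x - w x)\<^sup>2)"
        by (intro integrableI_bounded) (auto simp: less_top[symmetric] top_unique)
      with le have "ennreal (\<integral>x. (S n x - w x)\<^sup>2 \<partial>M) \<le> ennreal e"
        by (simp add: nn_integral_eq_integral)
      with i \<open>e > 0\<close> show ?thesis by (simp add: ennreal_le_iff)
    qed
    then show ?thesis by blast
  qed
  obtain N where "integrable M (\<lambda>x. (S N x - w x)\<^sup>2)" using small[of 1] by auto
  then have "square_integrable M (\<lambda>x. S N x - w x)" by (simp add: square_integrable_def)
  \<comment> \<open>Uses \<open>w = S N - (S N - w)\<close>.\<close>
  from square_integrable_diff[OF S[of N] this] have "square_integrable M w" by simp
  moreover have "(\<lambda>n. \<integral>x. (S n x - w x)\<^sup>2 \<partial>M) \<longlonglongrightarrow> 0"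
  proof (rule LIMSEQ_I)
    fix e :: real assume "e > 0"
    \<comment> \<open>Half of \<open>e\<close> turns the non-strict bound of \<open>small\<close>
      into a strict one.\<close>
    then obtain N where "\<forall>n\<ge>N. (\<integral>x. (S n x - w x)\<^sup>2 \<partial>M) \<le> e / 2"
      using small[of "e/2"] by auto
    with \<open>e > 0\<close> show "\<exists>N. \<forall>n\<ge>N. norm ((\<integral>x. (S n x - w x)\<^sup>2 \<partial>M) - 0) < e"
      by (intro exI[of _ N]) force
  qed
  ultimately show thesis by (rule that)
qed

section \<open>Expansions in an orthogonal sequence\<close>

locale orthogonal_sequence = finite_measure M for M :: "'a measure" +
  fixes e :: "nat \<Rightarrow> 'a \<Rightarrow> real" and c :: real
  assumes c_pos: "c > 0"
    and square_integrable_e: "square_integrable M (e k)"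
    and orthogonal: "(\<integral>x. e k x * e l x \<partial>M) = (if k = l then c else 0)"
begin

lemma square_integrable_combination: "square_integrable M (\<lambda>x. \<Sum>k\<in>A. a k * e k x)"
  by (intro square_integrable_sum square_integrable_cmult square_integrable_e)

lemma integral_mult_combination:
  assumes "square_integrable M v"
  shows "(\<integral>x. v x * (\<Sum>k\<in>A. a k * e k x) \<partial>M) = (\<Sum>k\<in>A. a k * (\<integral>x. v x * e k x \<partial>M))"
proof -
  have "(\<integral>x. v x * (\<Sum>k\<in>A. a k * e k x) \<partial>M) = (\<integral>x. (\<Sum>k\<in>A. a k * (v x * e k x)) \<partial>M)"
    by (simp add: sum_distrib_left mult.left_commute)
  then show ?thesis
    using square_integrable_mult_integrable[OF assms square_integrable_e] by simp
qed

lemma integral_combination_e: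
  assumes "finite A"
  shows "(\<integral>x. (\<Sum>k\<in>A. a k * e k x) * e l x \<partial>M) = (if l \<in> A then c * a l else 0)"
proof -
  have "(\<integral>x. (\<Sum>k\<in>A. a k * e k x) * e l x \<partial>M) = (\<Sum>k\<in>A. a k * (\<integral>x. e l x * e k x \<partial>M))"
    using integral_mult_combination[OF square_integrable_e[of l], where A = A and a = a] by (simp add: mult.commute)
  also have "\<dots> = (\<Sum>k\<in>A. if k = l then c * a l else 0)"
    by (intro sum.cong) (auto simp: orthogonal)
  finally show ?thesis using assms by simp
qed

lemma integral_combination_square:
  assumes "finite A"
  shows "(\<integral>x. (\<Sum>k\<in>A. a k * e k x)\<^sup>2 \<partial>M) = c * (\<Sum>k\<in>A. (a k)\<^sup>2)"
proof -
  have "(\<integral>x. (\<Sum>k\<in>A. a k * e k x)\<^sup>2 \<partial>M) =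
      (\<Sum>k\<in>A. a k * (\<integral>x. (\<Sum>k\<in>A. a k * e k x) * e k x \<partial>M))"
    unfolding power2_eq_square by (rule integral_mult_combination[OF square_integrable_combination])
  also have "\<dots> = (\<Sum>k\<in>A. c * (a k)\<^sup>2)"
    by (intro sum.cong) (auto simp: integral_combination_e[OF assms] power2_eq_square)
  finally show ?thesis by (simp add: sum_distrib_left)
qed

text \<open>Expanding the nonnegative squared distance from \<open>v\<close> to its partial sum
  bounds all partial sums of the squares by one constant.\<close>

lemma Bessel_summable:
  assumes v: "square_integrable M v" and a: "\<And>k. a k = (\<integral>x. v x * e k x \<partial>M) / c"
  shows "summable (\<lambda>k. (a k)\<^sup>2)"
proof (rule bounded_imp_summable)
  show "(a k)\<^sup>2 \<ge> 0" for k by simp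
  fix n
  let ?S = "\<lambda>x. \<Sum>k\<le>n. a k * e k x"
  have S: "square_integrable M ?S" by (rule square_integrable_combination)
  have "0 \<le> (\<integral>x. (v x - ?S x)\<^sup>2 \<partial>M)" by simp
  also have "\<dots> = (\<integral>x. (v x)\<^sup>2 - 2 * (v x * ?S x) + (?S x)\<^sup>2 \<partial>M)"
    by (simp add: power2_diff algebra_simps)
  also have "\<dots> = (\<integral>x. (v x)\<^sup>2 \<partial>M) - 2 * (\<integral>x. v x * ?S x \<partial>M) + (\<integral>x. (?S x)\<^sup>2 \<partial>M)"
    using v S square_integrable_mult_integrable[OF v S] by (simp add: square_integrable_def)
  also have "(\<integral>x. v x * ?S x \<partial>M) = c * (\<Sum>k\<le>n. (a k)\<^sup>2)"
    using c_pos by (simp add: integral_mult_combination[OF v]) (simp add: sum_distrib_left a power2_eq_square)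
  finally have "c * (\<Sum>k\<le>n. (a k)\<^sup>2) \<le> (\<integral>x. (v x)\<^sup>2 \<partial>M)"
    by (simp add: integral_combination_square)
  then show "(\<Sum>k\<le>n. (a k)\<^sup>2) \<le> (\<integral>x. (v x)\<^sup>2 \<partial>M) / c"
    using c_pos by (simp add: field_simps)
qed

text \<open>By orthogonality the squared distance of two partial sums is \<open>c\<close> times a
  block of the series of squares, so the Cauchy property carries over and Riesz-Fischer supplies the
  limit.\<close>

lemma square_summable_imp_L2_convergent:
  assumes a: "summable (\<lambda>k. (a k)\<^sup>2)"
  obtains w where "square_integrable M w"
    "(\<lambda>n. \<integral>x. ((\<Sum>k<n. a k * e k x) - w x)\<^sup>2 \<partial>M) \<longlonglongrightarrow> 0"
proof (rule Riesz_Fischer[of "\<lambda>n x. \<Sum>k<n. a k * e k x"])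
  fix \<epsilon> :: real assume \<epsilon>: "\<epsilon> > 0"
  obtain N where N: "\<And>m n. m \<ge> N \<Longrightarrow> norm (\<Sum>k\<in>{m..<n}. (a k)\<^sup>2) < \<epsilon> / c"
    using a[unfolded summable_Cauchy] \<epsilon> c_pos by (metis divide_pos_pos)
  have less: "(\<integral>x. ((\<Sum>k<n. a k * e k x) - (\<Sum>k<m. a k * e k x))\<^sup>2 \<partial>M) < \<epsilon>"
    if "m \<ge> N" "m \<le> n" for m n
  proof -
    have "(\<Sum>k<n. a k * e k x) - (\<Sum>k<m. a k * e k x) = (\<Sum>k\<in>{m..<n}. a k * e k x)" for x
      using sum_diff_nat_ivl[of 0 m n "\<lambda>k. a k * e k x"] that by (simp add: atLeast0LessThan)
    then have "(\<integral>x. ((\<Sum>k<n. a k * e k x) - (\<Sum>k<m. a k * e k x))\<^sup>2 \<partial>M) = c * (\<Sum>k\<in>{m..<n}. (a k)\<^sup>2)"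
      by (simp add: integral_combination_square)
    also have "\<dots> < \<epsilon>" using N[OF that(1), of n] c_pos by (simp add: field_simps sum_nonneg)
    finally show ?thesis .
  qed
  have "(\<integral>x. ((\<Sum>k<m. a k * e k x) - (\<Sum>k<n. a k * e k x))\<^sup>2 \<partial>M) < \<epsilon>" if "m \<ge> N" "n \<ge> N" for m n
    using less[of m n] less[of n m] that by (cases "m \<le> n") (simp_all add: power2_commute)
  then show "\<exists>N. \<forall>m\<ge>N. \<forall>n\<ge>N. (\<integral>x. ((\<Sum>k<m. a k * e k x) - (\<Sum>k<n. a k * e k x))\<^sup>2 \<partial>M) < \<epsilon>"
    by blast
qed (auto intro: square_integrable_combination that)

text \<open>The series has some limit \<open>w\<close> by Bessel and Riesz-Fischer. It has the same
  coefficients as \<open>v\<close>, so \<open>w - v\<close> is orthogonal to every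
  \<open>e k\<close> and vanishes by totality.\<close>

lemma total_imp_L2_convergent:
  assumes total: "\<And>u. square_integrable M u \<Longrightarrow> (\<And>k. (\<integral>x. u x * e k x \<partial>M) = 0) \<Longrightarrow> AE x in M. u x = 0"
    and v: "square_integrable M v" and a: "\<And>k. a k = (\<integral>x. v x * e k x \<partial>M) / c"
  shows "(\<lambda>n. \<integral>x. ((\<Sum>k<n. a k * e k x) - v x)\<^sup>2 \<partial>M) \<longlonglongrightarrow> 0"
proof -
  obtain w where w: "square_integrable M w"
    and lim: "(\<lambda>n. \<integral>x. ((\<Sum>k<n. a k * e k x) - w x)\<^sup>2 \<partial>M) \<longlonglongrightarrow> 0"
    using square_summable_imp_L2_convergent[OF Bessel_summable[OF v a]] .
  have ca: "c * a l = (\<integral>x. v x * e l x \<partial>M)" for l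
    using a[of l] c_pos by simp
  have "(\<integral>x. (w x - v x) * e l x \<partial>M) = 0" for l
  proof -
    have "(\<lambda>n. \<integral>x. (\<Sum>k<n. a k * e k x) * e l x \<partial>M) \<longlonglongrightarrow> (\<integral>x. w x * e l x \<partial>M)"
      by (rule tendsto_integral_mult[OF _ w _ _ lim])
         (auto intro: square_integrable_combination square_integrable_e)
    \<comment> \<open>Once \<open>n > l\<close> the term \<open>l\<close> belongs to the sum and is
      the only one that contributes, so the sequence is eventually constant.\<close>
    moreover have "\<forall>\<^sub>F n in sequentially. (\<integral>x. (\<Sum>k<n. a k * e k x) * e l x \<partial>M) = (\<integral>x. v x * e l x \<partial>M)"
      using eventually_gt_at_top[of l]
      by eventually_elim (simp add: integral_combination_e ca)
    ultimately have "(\<integral>x. w x * e l x \<partial>M) = (\<integral>x. v x * e l x \<partial>M)"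
      by (rule LIMSEQ_unique[OF _ tendsto_eventually])
    then show ?thesis
      using square_integrable_mult_integrable[OF w square_integrable_e]
        square_integrable_mult_integrable[OF v square_integrable_e]
      by (simp add: left_diff_distrib)
  qed
  then have AE0: "AE x in M. w x - v x = 0"
    by (intro total square_integrable_diff w v)
  have "(\<integral>x. ((\<Sum>k<n. a k * e k x) - w x)\<^sup>2 \<partial>M) = (\<integral>x. ((\<Sum>k<n. a k * e k x) - v x)\<^sup>2 \<partial>M)" for n
    using square_integrable_diff[OF square_integrable_combination w]
      square_integrable_diff[OF square_integrable_combination v] AE0
    by (intro integral_cong_AE) (auto simp: square_integrable_def intro!: borel_measurable_power)
  with lim show ?thesis by simp
qed

end

subsection \<open>Totality of the sine system\<close>

text \<open>The measure lives on the open interval, whereas the fundamental theorem is applied to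
  the Henstock-Kurzweil integral on the closed one; the endpoints carry no mass.\<close>

lemma integral_lebesgue_on_Ioo_FTC:
  fixes F f :: "real \<Rightarrow> real"
  assumes "a \<le> b" and F: "\<And>x. (F has_real_derivative f x) (at x)" and f: "continuous_on UNIV f"
  shows "integral\<^sup>L (lebesgue_on {a<..<b}) f = F b - F a"
proof -
  have "integrable (lebesgue_on {a..b}) f"
    using f by (intro continuous_imp_integrable_real) (rule continuous_on_subset, auto)
  then have "integrable (lebesgue_on {a<..<b}) f"
    by (metis absolutely_integrable_on_Icc_iff_Ioo integrable_restrict_space set_integrable_def
        lmeasurable_interval(2) fmeasurableD sets.Int_space_eq2 lmeasurable_cbox interval_cbox)
  then have "integral\<^sup>L (lebesgue_on {a<..<b}) f = integral {a<..<b} f"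
    by (intro lebesgue_integral_eq_integral) auto
  also have "\<dots> = integral {a..b} f"
    by (simp add: integral_open_interval_real)
  also have "\<dots> = F b - F a"
    using F assms(1) by (intro integral_unique fundamental_theorem_of_calculus)
      (auto simp: has_real_derivative_iff_has_vector_derivative[symmetric] intro: has_field_derivative_at_within)
  finally show ?thesis .
qed

lemma finite_measure_interval: "finite_measure (interval_measure_0T T)"
  by (intro finite_measure_lebesgue_on) auto

lemma borel_measurable_lebesgue_on_continuous:
  fixes f :: "real \<Rightarrow> real"
  assumes "continuous_on UNIV f" "S \<in> sets lebesgue"
  shows "f \<in> borel_measurable (lebesgue_on S)"
  using assms continuous_on_subset[of UNIV f S] by (intro continuous_imp_measurable_on_sets_lebesgue) auto

lemma integrable_mult_bounded_function:
  fixes f g :: "'a \<Rightarrow> real"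
  assumes f: "integrable M f" and g: "g \<in> borel_measurable M" and B: "\<And>x. x \<in> space M \<Longrightarrow> \<bar>g x\<bar> \<le> B"
  shows "integrable M (\<lambda>x. f x * g x)"
proof (rule Bochner_Integration.integrable_bound)
  show "integrable M (\<lambda>x. B * f x)" using f by simp
  show "(\<lambda>x. f x * g x) \<in> borel_measurable M" using f g by (intro borel_measurable_times) auto
  show "AE x in M. norm (f x * g x) \<le> norm (B * f x)"
  proof (rule AE_I2)
    fix x assume "x \<in> space M"
    then have "\<bar>g x\<bar> \<le> \<bar>B\<bar>" using B by fastforce
    then show "norm (f x * g x) \<le> norm (B * f x)"
      by (simp add: abs_mult mult.commute[of "\<bar>f x\<bar>"] mult_right_mono)
  qed
qed

lemma (in finite_measure) square_integrable_bounded: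
  fixes g :: "'a \<Rightarrow> real"
  assumes "g \<in> borel_measurable M" "\<And>x. x \<in> space M \<Longrightarrow> \<bar>g x\<bar> \<le> B"
  shows "square_integrable M g"
proof -
  have i: "integrable M g"
    using integrable_mult_bounded_function[of M "\<lambda>x. 1" g B] assms by simp
  show ?thesis
    using integrable_mult_bounded_function[OF i assms] assms(1)
    by (simp add: square_integrable_def power2_eq_square)
qed

text \<open>Measurable functions are almost everywhere limits of continuous ones, so testing against
  continuous approximations of the truncation of \<open>f\<close> to \<open>[-1,1]\<close> suffices.\<close>

lemma AE_zero_if_orthogonal_to_continuous:
  fixes f :: "real \<Rightarrow> real"
  assumes S: "S \<in> sets lebesgue" and f: "integrable (lebesgue_on S) f"
    and ortho: "\<And>g. continuous_on UNIV g \<Longrightarrow> (\<And>x. \<bar>g x\<bar> \<le> 1) \<Longrightarrow> (\<integral>x. f x * g x \<partial>lebesgue_on S) = 0"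
  shows "AE x in lebesgue_on S. f x = 0"
proof -
  \<comment> \<open>A bounded continuous stand-in for the sign function: \<open>y * trunc y\<close>
    is nonnegative and vanishes only at 0, so it is enough that the integral of
    \<open>f x * trunc (f x)\<close> is 0.\<close>
  define trunc :: "real \<Rightarrow> real" where "trunc y = max (-1) (min 1 y)" for y
  have trunc_le: "\<bar>trunc y\<bar> \<le> 1" for y by (auto simp: trunc_def)
  have cont_trunc: "continuous_on UNIV trunc"
    unfolding trunc_def by (intro continuous_intros)
  have nn: "0 \<le> y * trunc y" for y
    by (cases "y \<ge> 0") (auto simp: trunc_def zero_le_mult_iff)
  have zero: "y = 0" if "y * trunc y = 0" for y
    using that by (auto simp: trunc_def max_def min_def split: if_splits)
  have fm: "f \<in> borel_measurable (lebesgue_on S)" using f by auto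
  then have "f measurable_on S" using S by (simp add: measurable_on_iff_borel_measurable)
  then obtain N g where N: "negligible N" and g: "\<And>n. continuous_on UNIV (g n)"
    and lim: "\<And>x. x \<notin> N \<Longrightarrow> (\<lambda>n. g n x) \<longlonglongrightarrow> (if x \<in> S then f x else 0)"
    unfolding measurable_on_def by blast
  have ct: "continuous_on UNIV (\<lambda>x. trunc (g n x))" for n
    using continuous_on_compose[OF g[of n] continuous_on_subset[OF cont_trunc]] by (simp add: o_def)
  have tf: "(\<lambda>x. trunc (f x)) \<in> borel_measurable (lebesgue_on S)"
    unfolding trunc_def by (intro borel_measurable_max borel_measurable_min borel_measurable_const fm)
  have "AE x in lebesgue. x \<notin> N"
    using N by (intro AE_not_in) (simp add: negligible_iff_null_sets)
  then have "AE x in lebesgue_on S. x \<notin> N"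
    using S by (subst AE_restrict_space_iff) auto
  then have AElim: "AE x in lebesgue_on S. (\<lambda>n. f x * trunc (g n x)) \<longlonglongrightarrow> f x * trunc (f x)"
    using AE_space
  proof eventually_elim
    case (elim x)
    then have "(\<lambda>n. g n x) \<longlonglongrightarrow> f x" using lim[of x] by simp
    then show ?case
      unfolding trunc_def by (intro tendsto_intros)
  qed
  have "(\<lambda>n. \<integral>x. f x * trunc (g n x) \<partial>lebesgue_on S) \<longlonglongrightarrow> (\<integral>x. f x * trunc (f x) \<partial>lebesgue_on S)"
  proof (rule integral_dominated_convergence)
    show "integrable (lebesgue_on S) (\<lambda>x. \<bar>f x\<bar>)" using f by simp
    show "(\<lambda>x. f x * trunc (f x)) \<in> borel_measurable (lebesgue_on S)"
      by (intro borel_measurable_times fm tf)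
    show "(\<lambda>x. f x * trunc (g n x)) \<in> borel_measurable (lebesgue_on S)" for n
      by (intro borel_measurable_times fm borel_measurable_lebesgue_on_continuous ct S)
    show "AE x in lebesgue_on S. norm (f x * trunc (g n x)) \<le> \<bar>f x\<bar>" for n
      using trunc_le by (auto simp: abs_mult mult_left_le)
  qed (rule AElim)
  moreover have "(\<integral>x. f x * trunc (g n x) \<partial>lebesgue_on S) = 0" for n
    by (rule ortho[OF ct trunc_le])
  ultimately have "(\<integral>x. f x * trunc (f x) \<partial>lebesgue_on S) = 0"
    by (simp add: LIMSEQ_const_iff)
  moreover have "integrable (lebesgue_on S) (\<lambda>x. f x * trunc (f x))"
    by (rule integrable_mult_bounded_function[OF f tf trunc_le])
  ultimately have "AE x in lebesgue_on S. f x * trunc (f x) = 0"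
    using integral_nonneg_eq_0_iff_AE[of "lebesgue_on S" "\<lambda>x. f x * trunc (f x)"] nn by simp
  then show ?thesis
    by eventually_elim (rule zero)
qed

text \<open>With \<open>\<theta> = \<pi>t/(2T)\<close> the sines are \<open>sin ((2k+1)\<theta>)\<close>. The identity
  \<open>cos\<^sup>2 \<theta> sin \<phi> = sin \<phi> / 2 + (sin (\<phi>+2\<theta>) + sin (\<phi>-2\<theta>)) / 4\<close> makes a function orthogonal to
  all of them orthogonal to \<open>sin \<theta> p(cos\<^sup>2 \<theta>)\<close> for every polynomial \<open>p\<close>, and
  \<open>cos\<^sup>2 \<theta>\<close> separates the points of \<open>[0,T]\<close>.\<close>

lemma sine_system_total:
  fixes u :: "real \<Rightarrow> real"
  assumes T: "T > 0" and u: "integrable (interval_measure_0T T) u"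
    and ortho: "\<And>k. (\<integral>t. u t * sin (freq k * (t / T)) \<partial>interval_measure_0T T) = 0"
  shows "AE t in interval_measure_0T T. u t = 0"
proof -
  let ?M = "interval_measure_0T T"
  define \<theta> where "\<theta> t = pi / 2 * (t / T)" for t :: real
  have c\<theta>: "continuous_on A \<theta>" for A
    unfolding \<theta>_def by (intro continuous_intros) (use T in auto)
  have meas: "g \<in> borel_measurable ?M" if "continuous_on UNIV g" for g :: "real \<Rightarrow> real"
    using that by (intro borel_measurable_lebesgue_on_continuous) auto
  have int1: "integrable ?M (\<lambda>t. u t * g t)"
    if "continuous_on UNIV g" "\<And>t. \<bar>g t\<bar> \<le> 1" for g :: "real \<Rightarrow> real"
    using that by (intro integrable_mult_bounded_function[OF u meas]) auto
  \<comment> \<open>The index \<open>j\<close> is an integer because the induction on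
    \<open>n\<close> uses both \<open>j + 1\<close> and \<open>j - 1\<close>, which leaves the
    natural numbers.\<close>
  let ?g = "\<lambda>n (j::int) t. cos (\<theta> t) ^ (2 * n) * sin ((2 * of_int j + 1) * \<theta> t)"
  have intg: "integrable ?M (\<lambda>t. u t * ?g n j t)" for n j
  proof (rule int1)
    show "continuous_on UNIV (?g n j)" by (intro continuous_intros c\<theta>)
    show "\<bar>?g n j t\<bar> \<le> 1" for t
      by (simp add: abs_mult power_abs mult_le_one power_le_one)
  qed
  have pow: "(\<integral>t. u t * ?g n j t \<partial>?M) = 0" for n j
  proof (induction n arbitrary: j)
    case 0
    have nat: "(\<integral>t. u t * sin ((2 * real k + 1) * \<theta> t) \<partial>?M) = 0" for k
    proof -
      have "(2 * real k + 1) * \<theta> t = freq k * (t / T)" for t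
        using T by (simp add: \<theta>_def freq_def field_simps)
      then show ?thesis using ortho[of k] by simp
    qed
    show ?case
    proof (cases "j \<ge> 0")
      case True
      then show ?thesis using nat[of "nat j"] by simp
    next
      case False
      \<comment> \<open>The reflection \<open>j\<close> to \<open>- j - 1\<close> changes the sign
        of \<open>2 * j + 1\<close>, so oddness of the sine reduces negative indices to the
        hypothesis.\<close>
      have "sin ((2 * of_int j + 1) * \<theta> t) = - sin ((2 * real (nat (- j - 1)) + 1) * \<theta> t)" for t
      proof -
        have "(2 * of_int j + 1) * \<theta> t = - ((2 * real (nat (- j - 1)) + 1) * \<theta> t)"
          using False by (simp add: algebra_simps)
        then show ?thesis by (metis sin_minus)
      qed
      then show ?thesis using nat[of "nat (- j - 1)"] by simp
    qed
  next
    case (Suc n)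
    have step: "?g (Suc n) j t = ?g n j t / 2 + ?g n (j + 1) t / 4 + ?g n (j - 1) t / 4" for t
    proof -
      let ?\<phi> = "(2 * of_int j + 1) * \<theta> t"
      have "(2 * of_int (j + 1) + 1) * \<theta> t = ?\<phi> + 2 * \<theta> t" "(2 * of_int (j - 1) + 1) * \<theta> t = ?\<phi> - 2 * \<theta> t"
        by (simp_all add: algebra_simps)
      moreover have "(cos (\<theta> t))\<^sup>2 * sin ?\<phi> = sin ?\<phi> / 2 + sin (?\<phi> + 2 * \<theta> t) / 4 + sin (?\<phi> - 2 * \<theta> t) / 4"
      proof -
        have "sin (?\<phi> + 2 * \<theta> t) + sin (?\<phi> - 2 * \<theta> t) = 2 * sin ?\<phi> * (2 * (cos (\<theta> t))\<^sup>2 - 1)"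
          unfolding cos_double_cos[symmetric] by (simp only: sin_add sin_diff)
        then show ?thesis by (simp add: algebra_simps)
      qed
      moreover have "cos (\<theta> t) ^ (2 * Suc n) = cos (\<theta> t) ^ (2 * n) * (cos (\<theta> t))\<^sup>2"
        by (simp add: power2_eq_square)
      ultimately show ?thesis by (simp only: mult.assoc) (simp add: algebra_simps)
    qed
    have "(\<integral>t. u t * ?g (Suc n) j t \<partial>?M) =
        (\<integral>t. (u t * ?g n j t) / 2 + (u t * ?g n (j + 1) t) / 4 + (u t * ?g n (j - 1) t) / 4 \<partial>?M)"
      unfolding step by (intro Bochner_Integration.integral_cong refl) (simp add: ring_distribs)
    also have "\<dots> = 0"
      using intg[of n j] intg[of n "j + 1"] intg[of n "j - 1"] Suc[of j] Suc[of "j + 1"] Suc[of "j - 1"]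
      by simp
    finally show ?case .
  qed
  \<comment> \<open>For \<open>j = 0\<close> every \<open>?g n j\<close> contains the factor sin
    \<theta>; moving it into \<open>u\<close> leaves orthogonality to all polynomials in cos^2
    \<theta>.\<close>
  define f where "f t = u t * sin (\<theta> t)" for t
  have f: "integrable ?M f"
    unfolding f_def by (intro int1 continuous_intros c\<theta>) auto
  have poly0: "(\<integral>t. f t * poly p ((cos (\<theta> t))\<^sup>2) \<partial>?M) = 0" for p
  proof -
    have "f t * poly p ((cos (\<theta> t))\<^sup>2) = (\<Sum>i\<le>degree p. coeff p i * (u t * ?g i 0 t))" for t
      by (simp add: f_def poly_altdef sum_distrib_left power_mult[symmetric] mult_ac)
    then show ?thesis using intg[of _ 0] pow[of _ 0] by simp
  qed
  interpret R: function_ring_on "range (\<lambda>p t. poly p ((cos (\<theta> t))\<^sup>2))" "{0..T}"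
  proof
    show "compact {0..T}" by simp
    show "continuous_on {0..T} g" if "g \<in> range (\<lambda>p t. poly p ((cos (\<theta> t))\<^sup>2))" for g
      using that by (auto intro!: continuous_intros c\<theta>)
    show "(\<lambda>_. c) \<in> range (\<lambda>p t. poly p ((cos (\<theta> t))\<^sup>2))" for c
      by (rule range_eqI[of _ _ "[:c:]"]) simp
    show "\<exists>g\<in>range (\<lambda>p t. poly p ((cos (\<theta> t))\<^sup>2)). g x \<noteq> g y"
      if "x \<in> {0..T}" "y \<in> {0..T}" "x \<noteq> y" for x y
    \<comment> \<open>The identity polynomial already separates points: \<theta> maps
      \<open>{0..T}\<close> injectively into [0, pi/2], where the cosine is injective and
      nonnegative, so squaring loses nothing.\<close>
    proof (rule bexI[OF _ rangeI[of _ "[:0, 1:]"]])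
      have \<theta>: "0 \<le> \<theta> z \<and> \<theta> z \<le> pi / 2" if "z \<in> {0..T}" for z
        using that T by (auto simp: \<theta>_def field_simps)
      have "\<theta> x \<noteq> \<theta> y" using that T by (simp add: \<theta>_def)
      then have "cos (\<theta> x) \<noteq> cos (\<theta> y)"
        using \<theta>[OF that(1)] \<theta>[OF that(2)] cos_inj_pi[of "\<theta> x" "\<theta> y"] pi_ge_zero by linarith
      moreover have "cos (\<theta> x) \<ge> 0" "cos (\<theta> y) \<ge> 0"
        using \<theta>[OF that(1)] \<theta>[OF that(2)] by (auto intro!: cos_ge_zero)
      ultimately show "poly [:0, 1:] ((cos (\<theta> x))\<^sup>2) \<noteq> poly [:0, 1:] ((cos (\<theta> y))\<^sup>2)"
        by (simp add: power2_eq_iff_nonneg)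
    qed
  next
    fix g h assume "g \<in> range (\<lambda>p t. poly p ((cos (\<theta> t))\<^sup>2))" "h \<in> range (\<lambda>p t. poly p ((cos (\<theta> t))\<^sup>2))"
    then obtain p q where pq: "g = (\<lambda>t. poly p ((cos (\<theta> t))\<^sup>2))" "h = (\<lambda>t. poly q ((cos (\<theta> t))\<^sup>2))"
      by blast
    show "(\<lambda>x. g x + h x) \<in> range (\<lambda>p t. poly p ((cos (\<theta> t))\<^sup>2))"
      by (rule range_eqI[of _ _ "p + q"]) (simp add: pq)
    show "(\<lambda>x. g x * h x) \<in> range (\<lambda>p t. poly p ((cos (\<theta> t))\<^sup>2))"
      by (rule range_eqI[of _ _ "p * q"]) (simp add: pq)
  qed
  have "AE t in ?M. f t = 0"
  proof (rule AE_zero_if_orthogonal_to_continuous[OF _ f])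
    fix g :: "real \<Rightarrow> real" assume g: "continuous_on UNIV g" and g1: "\<And>x. \<bar>g x\<bar> \<le> 1"
    have ifg: "integrable ?M (\<lambda>t. f t * g t)"
      by (rule integrable_mult_bounded_function[OF f meas[OF g] g1])
    \<comment> \<open>Replacing \<open>g\<close> by \<open>g\<close> minus a uniformly close
      polynomial in cos^2 \<theta> does not change the integral, by \<open>poly0\<close>.\<close>
    have bound: "\<bar>\<integral>t. f t * g t \<partial>?M\<bar> \<le> e * (\<integral>t. \<bar>f t\<bar> \<partial>?M)" if "e > 0" for e
    proof -
      obtain p where p: "\<And>t. t \<in> {0..T} \<Longrightarrow> \<bar>g t - poly p ((cos (\<theta> t))\<^sup>2)\<bar> < e"
        using R.Stone_Weierstrass_basic[OF continuous_on_subset[OF g subset_UNIV] \<open>e > 0\<close>] by blast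
      let ?d = "\<lambda>t. g t - poly p ((cos (\<theta> t))\<^sup>2)"
      have fd: "integrable ?M (\<lambda>t. f t * ?d t)"
        by (rule integrable_mult_bounded_function[OF f, of _ e])
           (use p in \<open>auto intro!: meas continuous_intros g c\<theta> less_imp_le\<close>)
      have "(\<integral>t. f t * g t \<partial>?M) = (\<integral>t. f t * g t \<partial>?M) - (\<integral>t. f t * poly p ((cos (\<theta> t))\<^sup>2) \<partial>?M)"
        by (simp add: poly0)
      also have "\<dots> = (\<integral>t. f t * ?d t \<partial>?M)"
      proof -
        have "integrable ?M (\<lambda>t. f t * g t - f t * ?d t)"
          by (intro Bochner_Integration.integrable_diff ifg fd)
        then have "integrable ?M (\<lambda>t. f t * poly p ((cos (\<theta> t))\<^sup>2))" by (simp add: algebra_simps)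
        with ifg show ?thesis by (simp add: right_diff_distrib)
      qed
      finally have "\<bar>\<integral>t. f t * g t \<partial>?M\<bar> \<le> (\<integral>t. \<bar>f t * ?d t\<bar> \<partial>?M)"
        using integral_norm_bound[of ?M "\<lambda>t. f t * ?d t"] by simp
      also have "\<dots> \<le> (\<integral>t. e * \<bar>f t\<bar> \<partial>?M)"
      proof (rule integral_mono)
        show "integrable ?M (\<lambda>t. \<bar>f t * ?d t\<bar>)" using fd by (rule integrable_abs)
        show "integrable ?M (\<lambda>t. e * \<bar>f t\<bar>)" using f by simp
        fix t assume "t \<in> space ?M"
        then have "\<bar>?d t\<bar> \<le> e" using p[of t] by (simp add: less_imp_le)
        then show "\<bar>f t * ?d t\<bar> \<le> e * \<bar>f t\<bar>"
          by (simp add: abs_mult mult.commute[of "\<bar>f t\<bar>"] mult_right_mono)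
      qed
      finally show ?thesis by simp
    qed
    define I where "I = (\<integral>t. \<bar>f t\<bar> \<partial>?M)"
    have "I \<ge> 0" by (simp add: I_def)
    have "\<bar>\<integral>t. f t * g t \<partial>?M\<bar> \<le> 0 + e" if "e > 0" for e
    proof -
      \<comment> \<open>Dividing by \<open>I + 1\<close> instead of \<open>I\<close> also covers
        \<open>I = 0\<close>.\<close>
      have "e / (I + 1) * I \<le> e" using that \<open>I \<ge> 0\<close> by (simp add: field_simps)
      with bound[of "e / (I + 1)"] that \<open>I \<ge> 0\<close> show ?thesis by (simp add: I_def[symmetric])
    qed
    then have "\<bar>\<integral>t. f t * g t \<partial>?M\<bar> \<le> 0" by (rule field_le_epsilon)
    then show "(\<integral>t. f t * g t \<partial>?M) = 0" by simp
  qed simp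
  then show ?thesis
    using AE_space
  proof eventually_elim
    case (elim t)
    \<comment> \<open>On the open interval sin \<theta> is positive and can be cancelled from
      \<open>f t = 0\<close>.\<close>
    then have "0 < \<theta> t" "\<theta> t < pi" using T pi_gt_zero by (auto simp: \<theta>_def field_simps)
    with elim show ?case using sin_gt_zero[of "\<theta> t"] by (simp add: f_def)
  qed
qed

subsection \<open>The quadratic form in the sine coefficients\<close>

text \<open>An integer \<open>m\<close> is allowed because differences of frequencies may be
  negative. For nonzero \<open>m\<close> the antiderivative is a multiple of a sine that vanishes at
  both endpoints.\<close>

lemma integral_cos_int_multiple:
  assumes T: "T > 0"
  shows "(\<integral>t. cos (of_int m * pi * (t / T)) \<partial>interval_measure_0T T) = (if m = 0 then T else 0)"
proof (cases "m = 0")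
  case True
  have "(\<integral>t. 1 \<partial>interval_measure_0T T) = T - (0 :: real)"
    using T by (intro integral_lebesgue_on_Ioo_FTC) (auto intro!: derivative_eq_intros)
  then show ?thesis using True by simp
next
  case False
  have "(\<integral>t. cos (of_int m * pi * (t / T)) \<partial>interval_measure_0T T) =
      sin (of_int m * pi * (T / T)) * T / (of_int m * pi) - sin (of_int m * pi * (0 / T)) * T / (of_int m * pi)"
    using T False
    by (intro integral_lebesgue_on_Ioo_FTC) (auto intro!: derivative_eq_intros continuous_intros)
  also have "\<dots> = 0"
    using T by (auto simp: sin_zero_iff_int2)
  finally show ?thesis using False by simp
qed

text \<open>Both sides equal \<open>T / pi\<close> times \<open>(1 - (-1) ^ Suc m) / Suc m\<close>.
  Writing this as a moment is what later exhibits the quadratic form as the integral of a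
  square.\<close>

lemma integral_sin_Suc_multiple:
  assumes T: "T > 0"
  shows "(\<integral>t. sin (real (Suc m) * pi * (t / T)) \<partial>interval_measure_0T T) =
    T / pi * integral {-1..1} (\<lambda>x. x ^ m)"
proof -
  have "(\<integral>t. sin (real (Suc m) * pi * (t / T)) \<partial>interval_measure_0T T) =
      - cos (real (Suc m) * pi * (T / T)) * T / (real (Suc m) * pi)
      - (- cos (real (Suc m) * pi * (0 / T)) * T / (real (Suc m) * pi))"
    using T
    by (intro integral_lebesgue_on_Ioo_FTC)
       (auto intro!: derivative_eq_intros continuous_intros simp del: of_nat_Suc)
  also have "\<dots> = T / pi * (1 / real (Suc m) - (-1) ^ Suc m / real (Suc m))"
    using T by (simp add: cos_npi field_simps del: of_nat_Suc)
  also have "1 / real (Suc m) - (-1) ^ Suc m / real (Suc m) = integral {-1..1} (\<lambda>x. x ^ m)"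
  proof -
    have "((\<lambda>x. x ^ m) has_integral (1 ^ Suc m / real (Suc m) - (-1) ^ Suc m / real (Suc m))) {-1..1}"
      by (intro fundamental_theorem_of_calculus)
         (auto simp: has_real_derivative_iff_has_vector_derivative[symmetric] simp del: of_nat_Suc power_Suc
           intro!: derivative_eq_intros)
    then show ?thesis by (simp add: integral_unique)
  qed
  finally show ?thesis .
qed

lemma square_integrable_sine_cosine:
  "square_integrable (interval_measure_0T T) (\<lambda>t. sin (freq k * (t / T)))"
  "square_integrable (interval_measure_0T T) (\<lambda>t. cos (freq k * (t / T)))"
proof -
  interpret finite_measure "interval_measure_0T T" by (rule finite_measure_interval)
  show "square_integrable (interval_measure_0T T) (\<lambda>t. sin (freq k * (t / T)))"
    "square_integrable (interval_measure_0T T) (\<lambda>t. cos (freq k * (t / T)))"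
    by (auto intro!: square_integrable_bounded[where B = 1] borel_measurable_lebesgue_on_continuous
        continuous_intros simp: divide_inverse)
qed

text \<open>The frequencies are half-odd multiples of pi, so sums and differences are integer
  multiples. The sum has factor \<open>k + l + 1\<close>, which is never 0.\<close>

lemma integral_cos_freq_diff_sum:
  assumes T: "T > 0"
  shows "(\<integral>t. cos (freq k * (t / T) - freq l * (t / T)) \<partial>interval_measure_0T T) = (if k = l then T else 0)"
    and "(\<integral>t. cos (freq k * (t / T) + freq l * (t / T)) \<partial>interval_measure_0T T) = 0"
proof -
  have "freq k * y - freq l * y = of_int (int k - int l) * pi * y"
    "freq k * y + freq l * y = of_int (int (Suc (k + l))) * pi * y" for y
    by (simp_all add: freq_def algebra_simps)
  then show "(\<integral>t. cos (freq k * (t / T) - freq l * (t / T)) \<partial>interval_measure_0T T) = (if k = l then T else 0)"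
    "(\<integral>t. cos (freq k * (t / T) + freq l * (t / T)) \<partial>interval_measure_0T T) = 0"
    by (simp_all only: integral_cos_int_multiple[OF T]) auto
qed

lemma integrable_cos_freq_diff_sum:
  "integrable (interval_measure_0T T) (\<lambda>t. cos (freq k * (t / T) - freq l * (t / T)))"
  "integrable (interval_measure_0T T) (\<lambda>t. cos (freq k * (t / T) + freq l * (t / T)))"
  unfolding cos_add cos_diff
  by (intro Bochner_Integration.integrable_add Bochner_Integration.integrable_diff
      square_integrable_mult_integrable square_integrable_sine_cosine)+

text \<open>The product-to-sum formula leaves half of two cosine integrals, of which only the
  difference term with \<open>k = l\<close> survives.\<close>

lemma orthogonal_sequence_sine:
  assumes T: "T > 0"
  shows "orthogonal_sequence (interval_measure_0T T) (\<lambda>k t. sin (freq k * (t / T))) (T / 2)"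
proof -
  interpret finite_measure "interval_measure_0T T" by (rule finite_measure_interval)
  show ?thesis
  proof
    show "(\<integral>t. sin (freq k * (t / T)) * sin (freq l * (t / T)) \<partial>interval_measure_0T T) =
        (if k = l then T / 2 else 0)" for k l
      unfolding sin_times_sin
      using integrable_cos_freq_diff_sum[of T k l] integral_cos_freq_diff_sum[OF T, of k l] by simp
  qed (use T in simp, rule square_integrable_sine_cosine)
qed

lemma orthogonal_sequence_cosine:
  assumes T: "T > 0"
  shows "orthogonal_sequence (interval_measure_0T T) (\<lambda>k t. cos (freq k * (t / T))) (T / 2)"
proof -
  interpret finite_measure "interval_measure_0T T" by (rule finite_measure_interval)
  show ?thesis
  proof
    show "(\<integral>t. cos (freq k * (t / T)) * cos (freq l * (t / T)) \<partial>interval_measure_0T T) =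
        (if k = l then T / 2 else 0)" for k l
      unfolding cos_times_cos
      using integrable_cos_freq_diff_sum[of T k l] integral_cos_freq_diff_sum[OF T, of k l] by simp
  qed (use T in simp, rule square_integrable_sine_cosine)
qed

text \<open>Symmetrising in \<open>k, l\<close> replaces \<open>sin\<^sub>k cos\<^sub>l\<close> by \<open>sin ((k+l+1)\<pi>t/T) / 2\<close>, whose integral is a
  moment of Lebesgue measure on \<open>[-1,1]\<close>.\<close>

lemma integral_sine_sum_cosine_sum:
  assumes T: "T > 0" and "finite A"
  shows "(\<integral>t. (\<Sum>k\<in>A. a k * sin (freq k * (t / T))) * (\<Sum>k\<in>A. a k * cos (freq k * (t / T))) \<partial>interval_measure_0T T)
    = T / (2 * pi) * integral {-1..1} (\<lambda>x. (\<Sum>k\<in>A. a k * x ^ k)\<^sup>2)"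
proof -
  interpret S: orthogonal_sequence "interval_measure_0T T" "\<lambda>k t. sin (freq k * (t / T))" "T / 2"
    using T by (rule orthogonal_sequence_sine)
  interpret C: orthogonal_sequence "interval_measure_0T T" "\<lambda>k t. cos (freq k * (t / T))" "T / 2"
    using T by (rule orthogonal_sequence_cosine)
  define J where "J k l = (\<integral>t. sin (freq k * (t / T)) * cos (freq l * (t / T)) \<partial>interval_measure_0T T)" for k l
  have J: "J k l + J l k = T / pi * integral {-1..1} (\<lambda>x. x ^ (k + l))" for k l
  proof -
    have "J k l + J l k = (\<integral>t. sin (freq k * (t / T)) * cos (freq l * (t / T)) +
        sin (freq l * (t / T)) * cos (freq k * (t / T)) \<partial>interval_measure_0T T)"
      unfolding J_def
      by (intro Bochner_Integration.integral_add[symmetric] square_integrable_mult_integrable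
          square_integrable_sine_cosine)
    also have "\<dots> = (\<integral>t. sin (real (Suc (k + l)) * pi * (t / T)) \<partial>interval_measure_0T T)"
    proof (intro Bochner_Integration.integral_cong refl)
      fix t
      have "real (Suc (k + l)) * pi * (t / T) = freq k * (t / T) + freq l * (t / T)"
        by (simp add: freq_def algebra_simps)
      then show "sin (freq k * (t / T)) * cos (freq l * (t / T)) + sin (freq l * (t / T)) * cos (freq k * (t / T))
          = sin (real (Suc (k + l)) * pi * (t / T))"
        by (simp only: sin_add) simp
    qed
    finally show ?thesis by (simp only: integral_sin_Suc_multiple[OF T])
  qed
  have eq: "(\<integral>t. (\<Sum>k\<in>A. a k * sin (freq k * (t / T))) * (\<Sum>k\<in>A. a k * cos (freq k * (t / T))) \<partial>interval_measure_0T T)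
      = (\<Sum>l\<in>A. \<Sum>k\<in>A. a l * a k * J k l)"
  proof -
    have "(\<integral>t. (\<Sum>k\<in>A. a k * sin (freq k * (t / T))) * cos (freq l * (t / T)) \<partial>interval_measure_0T T)
        = (\<Sum>k\<in>A. a k * J k l)" for l
      using S.integral_mult_combination[OF square_integrable_sine_cosine(2)[of T l], where A = A and a = a]
      by (simp add: J_def mult.commute)
    then show ?thesis
      unfolding C.integral_mult_combination[OF S.square_integrable_combination]
      by (simp only: sum_distrib_left mult.assoc)
  qed
  \<comment> \<open>Exchanging the indices in one of the two copies puts the symmetric combination
    evaluated in \<open>J\<close> under the sum.\<close>
  have "2 * (\<Sum>l\<in>A. \<Sum>k\<in>A. a l * a k * J k l) = (\<Sum>l\<in>A. \<Sum>k\<in>A. a l * a k * (J k l + J l k))"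
    using sum.swap[of "\<lambda>l k. a l * a k * J k l" A A]
    by (simp add: ring_distribs sum.distrib mult.commute[of "a _" "a _"])
  also have "\<dots> = T / pi * (\<Sum>l\<in>A. \<Sum>k\<in>A. integral {-1..1} (\<lambda>x. a l * x ^ l * (a k * x ^ k)))"
    unfolding sum_distrib_left
  proof (intro sum.cong refl)
    fix l k
    have "(\<lambda>x::real. a l * x ^ l * (a k * x ^ k)) = (\<lambda>x. (a l * a k) * x ^ (k + l))"
      by (simp add: fun_eq_iff power_add)
    then show "a l * a k * (J k l + J l k) = T / pi * integral {-1..1} (\<lambda>x. a l * x ^ l * (a k * x ^ k))"
      by (simp add: J)
  qed
  also have "(\<Sum>l\<in>A. \<Sum>k\<in>A. integral {-1..1} (\<lambda>x. a l * x ^ l * (a k * x ^ k)))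
      = integral {-1..1} (\<lambda>x. \<Sum>l\<in>A. \<Sum>k\<in>A. a l * x ^ l * (a k * x ^ k))"
    using \<open>finite A\<close>
    by (subst integral_sum | intro refl sum.cong integrable_sum integrable_continuous_real continuous_intros | assumption)+
  also have "(\<lambda>x. \<Sum>l\<in>A. \<Sum>k\<in>A. a l * x ^ l * (a k * x ^ k)) = (\<lambda>x. (\<Sum>k\<in>A. a k * x ^ k)\<^sup>2)"
    by (simp add: power2_eq_square sum_product)
  finally show ?thesis using eq by simp
qed

text \<open>Near \<open>0\<close> the lowest nonvanishing coefficient dominates every later partial sum.\<close>

lemma power_sum_square_integral_lower_bound:
  fixes a :: "nat \<Rightarrow> real"
  assumes B: "\<And>k. \<bar>a k\<bar> \<le> B" and "a j \<noteq> 0"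
  obtains \<delta> N where "\<delta> > 0" "\<And>n. n > N \<Longrightarrow> \<delta> \<le> integral {-1..1} (\<lambda>x. (\<Sum>k<n. a k * x ^ k)\<^sup>2)"
proof -
  define m where "m = (LEAST k. a k \<noteq> 0)"
  have am: "a m \<noteq> 0" and below: "k < m \<Longrightarrow> a k = 0" for k
    using LeastI[of "\<lambda>k. a k \<noteq> 0" j] not_less_Least[of k "\<lambda>k. a k \<noteq> 0"] \<open>a j \<noteq> 0\<close> by (auto simp: m_def)
  \<comment> \<open>Chosen so that \<open>2 * B * r\<close> is half of the leading coefficient in
    absolute value; \<open>r\<close> is at most 1/4 since \<open>B\<close> bounds that
    coefficient.\<close>
  define r where "r = \<bar>a m\<bar> / (4 * B)"
  have Bpos: "B > 0" using B[of m] am by linarith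
  have r: "0 < r" "r \<le> 1 / 4" using am Bpos B[of m] by (auto simp: r_def field_simps)
  \<comment> \<open>On \<open>{0..r}\<close> a geometric series bounds the terms after index
    \<open>m\<close> by half of the leading term, so at least the other half remains, uniformly in
    \<open>n\<close>.\<close>
  have lower: "(\<bar>a m\<bar> / 2 * x ^ m)\<^sup>2 \<le> (\<Sum>k<n. a k * x ^ k)\<^sup>2" if "n > m" "x \<in> {0..r}" for n x
  proof -
    have x: "0 \<le> x" "x \<le> r" "x \<le> 1 / 4" using that r by auto
    have "(\<Sum>k<n. a k * x ^ k) = (\<Sum>k\<in>{m..<n}. a k * x ^ k)"
      using below by (intro sum.mono_neutral_right) (auto simp: not_le)
    also have "\<dots> = a m * x ^ m + (\<Sum>k\<in>{Suc m..<n}. a k * x ^ k)"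
      using that by (simp add: sum.atLeast_Suc_lessThan)
    finally have split: "(\<Sum>k<n. a k * x ^ k) = a m * x ^ m + (\<Sum>k\<in>{Suc m..<n}. a k * x ^ k)" .
    have "\<bar>\<Sum>k\<in>{Suc m..<n}. a k * x ^ k\<bar> \<le> (\<Sum>k\<in>{Suc m..<n}. B * x ^ k)"
      using x B by (intro order_trans[OF sum_abs] sum_mono) (auto simp: abs_mult intro!: mult_right_mono)
    also have "\<dots> \<le> B * (x ^ Suc m * 2)"
    proof -
      have "(\<Sum>k\<in>{Suc m..<n}. x ^ k) = (\<Sum>i<n - Suc m. x ^ (Suc m + i))"
        using that sum.shift_bounds_nat_ivl[of "\<lambda>k. x ^ k" 0 "Suc m" "n - Suc m"]
        by (simp add: atLeast0LessThan add.commute)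
      also have "\<dots> = x ^ Suc m * (\<Sum>i<n - Suc m. x ^ i)" by (simp add: power_add sum_distrib_left mult.assoc)
      also have "\<dots> \<le> x ^ Suc m * 2"
      proof (rule mult_left_mono)
        have "(\<Sum>i<n - Suc m. x ^ i) \<le> (\<Sum>i. x ^ i)"
          using x by (intro sum_le_suminf summable_geometric) auto
        also have "\<dots> = 1 / (1 - x)" using x by (intro suminf_geometric) auto
        also have "\<dots> \<le> 2" using x by (simp add: field_simps)
        finally show "(\<Sum>i<n - Suc m. x ^ i) \<le> 2" .
      qed (use x in simp)
      finally have "(\<Sum>k\<in>{Suc m..<n}. x ^ k) \<le> x ^ Suc m * 2" .
      then show ?thesis using Bpos by (simp add: sum_distrib_left[symmetric])
    qed
    also have "\<dots> = 2 * B * x * x ^ m" by simp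
    also have "\<dots> \<le> \<bar>a m\<bar> / 2 * x ^ m"
    proof (rule mult_right_mono)
      have "2 * B * x \<le> 2 * B * r" using x Bpos by (intro mult_left_mono) auto
      also have "\<dots> = \<bar>a m\<bar> / 2" using Bpos by (simp add: r_def)
      finally show "2 * B * x \<le> \<bar>a m\<bar> / 2" .
    qed (use x in simp)
    finally have rest: "\<bar>\<Sum>k\<in>{Suc m..<n}. a k * x ^ k\<bar> \<le> \<bar>a m\<bar> / 2 * x ^ m" .
    have "\<bar>a m * x ^ m\<bar> = \<bar>a m\<bar> * x ^ m" using x by (simp add: abs_mult)
    with rest have "\<bar>a m\<bar> / 2 * x ^ m \<le> \<bar>\<Sum>k<n. a k * x ^ k\<bar>"
      unfolding split by linarith
    then have "(\<bar>a m\<bar> / 2 * x ^ m)\<^sup>2 \<le> \<bar>\<Sum>k<n. a k * x ^ k\<bar>\<^sup>2"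
      using x by (intro power_mono) auto
    then show ?thesis by simp
  qed
  show thesis
  proof
    \<comment> \<open>The witnesses are \<open>N = m\<close> and, for \<delta>, the integral over
      \<open>{0..r}\<close> of the squared half leading term; this is its explicit value.\<close>
    have "0 < (\<bar>a m\<bar> / 2)\<^sup>2 * (r ^ Suc (2 * m) / real (Suc (2 * m)))"
      using am r by simp
    then show "0 < integral {0..r} (\<lambda>x. (\<bar>a m\<bar> / 2 * x ^ m)\<^sup>2)"
    proof -
      have "((\<lambda>x. x ^ (2 * m)) has_integral (r ^ Suc (2 * m) / real (Suc (2 * m)) - 0 ^ Suc (2 * m) / real (Suc (2 * m)))) {0..r}"
        using r
        by (intro fundamental_theorem_of_calculus)
           (auto simp: has_real_derivative_iff_has_vector_derivative[symmetric] simp del: of_nat_Suc power_Suc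
             intro!: derivative_eq_intros)
      then have "integral {0..r} (\<lambda>x. x ^ (2 * m)) = r ^ Suc (2 * m) / real (Suc (2 * m))"
        by (simp add: integral_unique)
      moreover have "(\<lambda>x. (\<bar>a m\<bar> / 2 * x ^ m)\<^sup>2) = (\<lambda>x. (\<bar>a m\<bar> / 2)\<^sup>2 * x ^ (2 * m))"
        by (simp only: power_mult_distrib power_even_eq)
      moreover note \<open>0 < (\<bar>a m\<bar> / 2)\<^sup>2 * (r ^ Suc (2 * m) / real (Suc (2 * m)))\<close>
      ultimately show ?thesis by (simp only: integral_mult_right)
    qed
    fix n assume "n > m"
    have "integral {0..r} (\<lambda>x. (\<bar>a m\<bar> / 2 * x ^ m)\<^sup>2) \<le> integral {0..r} (\<lambda>x. (\<Sum>k<n. a k * x ^ k)\<^sup>2)"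
      by (intro integral_le integrable_continuous_real continuous_intros lower[OF \<open>n > m\<close>]) auto
    \<comment> \<open>The integrand is a square, so enlarging the interval only increases the
      integral.\<close>
    also have "\<dots> \<le> integral {-1..1} (\<lambda>x. (\<Sum>k<n. a k * x ^ k)\<^sup>2)"
      using r by (intro integral_subset_le integrable_continuous_real continuous_intros) auto
    finally show "integral {0..r} (\<lambda>x. (\<bar>a m\<bar> / 2 * x ^ m)\<^sup>2) \<le> integral {-1..1} (\<lambda>x. (\<Sum>k<n. a k * x ^ k)\<^sup>2)" .
  qed
qed

section \<open>Positivity in the limit\<close>

lemma L2_space_eq: "L2_space T = Collect (square_integrable (interval_measure_0T T))"
  by (auto simp: L2_space_def square_integrable_def)

lemma Hs_0_space_subset_L2_space: "Hs_0_space T s \<subseteq> L2_space T"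
  by (auto simp: Hs_0_space_def H1_0_space_def H1_space_def)

theorem lemma2p2:
  fixes T s :: real and v :: "real \<Rightarrow> real"
  assumes "T > 0"
    and "0 < s" and "s \<le> 1"
    and "v \<in> Hs_0_space T s"
    and "\<not> L2_eq T v (\<lambda>t. 0)"
  shows "L2_inner T v (modified_Hilbert T v) > 0"
proof -
  let ?M = "interval_measure_0T T"
  define a where "a = sine_coeff T v"
  let ?S = "\<lambda>n t. \<Sum>k<n. a k * sin (freq k * (t / T))"
  let ?C = "\<lambda>n t. \<Sum>k<n. a k * cos (freq k * (t / T))"
  interpret S: orthogonal_sequence ?M "\<lambda>k t. sin (freq k * (t / T))" "T / 2"
    using \<open>T > 0\<close> by (rule orthogonal_sequence_sine)
  interpret C: orthogonal_sequence ?M "\<lambda>k t. cos (freq k * (t / T))" "T / 2"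
    using \<open>T > 0\<close> by (rule orthogonal_sequence_cosine)
  have v: "square_integrable ?M v"
    using \<open>v \<in> Hs_0_space T s\<close> Hs_0_space_subset_L2_space by (auto simp: L2_space_eq)
  have a: "a k = (\<integral>t. v t * sin (freq k * (t / T)) \<partial>?M) / (T / 2)" for k
    by (simp add: a_def sine_coeff_def)
  have total: "AE t in ?M. u t = 0"
    if u: "square_integrable ?M u" and "\<And>k. (\<integral>t. u t * sin (freq k * (t / T)) \<partial>?M) = 0" for u
  proof (rule sine_system_total[OF \<open>T > 0\<close> _ that(2)])
    have "square_integrable ?M (\<lambda>t. 1)" by (rule S.square_integrable_bounded[where B = 1]) auto
    from square_integrable_mult_integrable[OF u this] show "integrable ?M u" by simp
  qed
  have a2: "summable (\<lambda>k. (a k)\<^sup>2)" by (rule S.Bessel_summable[OF v a])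
  have S_lim: "(\<lambda>n. \<integral>t. (?S n t - v t)\<^sup>2 \<partial>?M) \<longlonglongrightarrow> 0"
    by (rule S.total_imp_L2_convergent[OF total v a])
  define w where "w = modified_Hilbert T v"
  have norm_eq: "L2_norm T (\<lambda>t. f t - g t) = sqrt (\<integral>t. (g t - f t)\<^sup>2 \<partial>?M)" for f g
    by (simp add: L2_norm_def L2_inner_def power2_eq_square[symmetric] power2_commute)
  \<comment> \<open>Existence of some limit of the cosine series is what makes the choice in
    \<open>modified_Hilbert\<close> satisfy its defining property.\<close>
  obtain w' where "square_integrable ?M w'" "(\<lambda>n. \<integral>t. (?C n t - w' t)\<^sup>2 \<partial>?M) \<longlonglongrightarrow> 0"
    using C.square_summable_imp_L2_convergent[OF a2] .
  then have "w' \<in> L2_space T \<and> (\<lambda>n. L2_norm T (\<lambda>t. w' t - ?C n t)) \<longlonglongrightarrow> 0"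
    unfolding norm_eq L2_space_eq by (auto intro!: tendsto_eq_intros)
  then have "w \<in> L2_space T \<and> (\<lambda>n. L2_norm T (\<lambda>t. w t - ?C n t)) \<longlonglongrightarrow> 0"
    unfolding w_def modified_Hilbert_def a_def[symmetric]
    by (rule someI[where P = "\<lambda>w. w \<in> L2_space T \<and> (\<lambda>n. L2_norm T (\<lambda>t. w t - ?C n t)) \<longlonglongrightarrow> 0"])
  then have w: "square_integrable ?M w" and w_lim: "(\<lambda>n. sqrt (\<integral>t. (?C n t - w t)\<^sup>2 \<partial>?M)) \<longlonglongrightarrow> 0"
    unfolding norm_eq L2_space_eq by auto
  \<comment> \<open>Squaring turns convergence of norms into convergence of the integrals of
    squares.\<close>
  have C_lim: "(\<lambda>n. \<integral>t. (?C n t - w t)\<^sup>2 \<partial>?M) \<longlonglongrightarrow> 0"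
    using tendsto_power[OF w_lim, of 2]
    by (simp only: real_sqrt_pow2 Bochner_Integration.integral_nonneg zero_le_power2 zero_power2)
  have "(\<lambda>n. \<integral>t. ?S n t * ?C n t \<partial>?M) \<longlonglongrightarrow> (\<integral>t. v t * w t \<partial>?M)"
    by (rule tendsto_integral_mult[OF S.square_integrable_combination v C.square_integrable_combination w S_lim C_lim])
  then have lim: "(\<lambda>n. T / (2 * pi) * integral {-1..1} (\<lambda>x. (\<Sum>k<n. a k * x ^ k)\<^sup>2)) \<longlonglongrightarrow> L2_inner T v w"
    by (simp only: integral_sine_sum_cosine_sum[OF \<open>T > 0\<close> finite_lessThan] L2_inner_def)
  \<comment> \<open>If all coefficients vanished, totality would give \<open>v = 0\<close> almost
    everywhere.\<close>
  obtain j where "a j \<noteq> 0"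
  proof (rule ccontr)
    assume "\<not> thesis"
    then have "a k = 0" for k using that by blast
    then have "AE t in ?M. v t = 0" using \<open>T > 0\<close> a by (intro total v) simp
    with \<open>\<not> L2_eq T v (\<lambda>t. 0)\<close> show False by (simp add: L2_eq_def)
  qed
  \<comment> \<open>Square summability sends the coefficients to 0, hence they are bounded.\<close>
  obtain B where B: "\<And>k. \<bar>a k\<bar> \<le> B"
  proof -
    have "(\<lambda>k. sqrt ((a k)\<^sup>2)) \<longlonglongrightarrow> sqrt 0"
      by (intro tendsto_real_sqrt summable_LIMSEQ_zero a2)
    then have "Bseq (\<lambda>k. \<bar>a k\<bar>)" by (auto intro: convergent_imp_Bseq convergentI)
    then show thesis using that by (auto simp: Bseq_def)
  qed
  obtain \<delta> N where "\<delta> > 0" and \<delta>: "\<And>n. n > N \<Longrightarrow> \<delta> \<le> integral {-1..1} (\<lambda>x. (\<Sum>k<n. a k * x ^ k)\<^sup>2)"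
    using power_sum_square_integral_lower_bound[where a = a, OF B \<open>a j \<noteq> 0\<close>] by blast
  \<comment> \<open>Positivity of each term alone would give only a nonnegative limit; the bound
    \<delta>, independent of \<open>n\<close>, keeps it strict.\<close>
  have "\<forall>\<^sub>F n in sequentially. T / (2 * pi) * \<delta> \<le> T / (2 * pi) * integral {-1..1} (\<lambda>x. (\<Sum>k<n. a k * x ^ k)\<^sup>2)"
    using eventually_gt_at_top[of N] by eventually_elim (use \<open>T > 0\<close> \<delta> in \<open>intro mult_left_mono; simp\<close>)
  from tendsto_lowerbound[OF lim this] have "T / (2 * pi) * \<delta> \<le> L2_inner T v w" by simp
  moreover have "0 < T / (2 * pi) * \<delta>" using \<open>T > 0\<close> \<open>\<delta> > 0\<close> by simp
  ultimately show ?thesis by (simp add: w_def)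
qed

end
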